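(* Let $\alpha_1,\alpha_2,\alpha_3\in\mathbb{C}$ with $2\alpha_1+2\alpha_2+\alpha_3=1$, and consider the Hamiltonian system $$(\ast)\qquad \frac{dx}{dt}=-2x^2+4y-3w-2t,\quad \frac{dy}{dt}=4xy+2\alpha_2,\quad \frac{dz}{dt}=z^2+2w-3y+t,\quad \frac{dw}{dt}=-2zw-\alpha_3 .$$ Then $(\ast)$ is equivalent to the following Hamiltonian systems. (1) By the rational and symplectic transformation $$\varphi_1:(x,y,z,w)\mapsto\left(x-\frac{(x+z)w-\alpha_1}{-t-w-x^2+y},\ -t-w-x^2+y,\ -w(-t-w-x^2+y),\ \frac{x+z}{-t-w-x^2+y}\right),$$ the system $(\ast)$ is transformed (writing the new variables again as $x,y,z,w$) to $$\frac{dx}{dt}=2x^2+4y+2t-zw^2+\alpha_3w,\quad \frac{dy}{dt}=-4xy+2zw+2\alpha_1,\quad \frac{dz}{dt}=-2xz-2yzw+\alpha_3y,\quad \frac{dw}{dt}=yw^2+2xw+1,$$ with the polynomial Hamiltonian $$2x^2y+2y^2+2ty-yzw^2+\alpha_3yw-2xzw-2\alpha_1x-z .$$ (2) By the symplectic transformation $$\varphi_2:(x,y,z,w)\mapsto(x,\ -t-w-x^2+y,\ -w,\ x+z),$$ the system $(\ast)$ is transformed (writing the new variables again as $x,y,z,w$) to $$\frac{dx}{dt}=2x^2+4y-z+2t,\quad \frac{dy}{dt}=-4xy-2zw-2\alpha_1,\quad \frac{dz}{dt}=-2zw+2xz+\alpha_3,\quad \frac{dw}{dt}=w^2-2xw+y,$$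 with the polynomial Hamiltonian $$2x^2y+2y^2-yz+2ty+2\alpha_1x+2xzw+\alpha_3w-zw^2 .$$
   Context: All variables are complex. A system is said to have Hamiltonian $H$ if $\frac{dx}{dt}=\frac{\partial H}{\partial y}$, $\frac{dy}{dt}=-\frac{\partial H}{\partial x}$, $\frac{dz}{dt}=\frac{\partial H}{\partial w}$, $\frac{dw}{dt}=-\frac{\partial H}{\partial z}$. The system $(\ast)$ has Hamiltonian $-2x^2y+2y^2-2ty-2\alpha_2x+z^2w+w^2+tw+\alpha_3z-3yw$. "Symplectic" means that for each fixed $t$ the map preserves the 2-form $dx\wedge dy+dz\wedge dw$. *)

theory Defs
  imports "HOL-Analysis.Analysis"
begin

type_synonym phase = "complex \<times> complex \<times> complex \<times> complex"

abbreviation px :: "phase \<Rightarrow> complex" where "px p \<equiv> fst p"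
abbreviation py :: "phase \<Rightarrow> complex" where "py p \<equiv> fst (snd p)"
abbreviation pz :: "phase \<Rightarrow> complex" where "pz p \<equiv> fst (snd (snd p))"
abbreviation pw :: "phase \<Rightarrow> complex" where "pw p \<equiv> snd (snd (snd p))"

definition cscale :: "complex \<Rightarrow> phase \<Rightarrow> phase" where
  "cscale c p = (c * px p, c * py p, c * pz p, c * pw p)"

text \<open>A non-autonomous system is given by its right-hand side, a function of the complex
  time and of the point. The derivatives are complex derivatives in \<open>t\<close>.\<close>

definition solution :: "(complex \<Rightarrow> phase \<Rightarrow> phase) \<Rightarrow> complex set \<Rightarrow> (complex \<Rightarrow> phase) \<Rightarrow> bool" where
  "solution V T u \<longleftrightarrow> (\<forall>t\<in>T.
     ((\<lambda>s. px (u s)) has_field_derivative px (V t (u t))) (at t) \<and>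
     ((\<lambda>s. py (u s)) has_field_derivative py (V t (u t))) (at t) \<and>
     ((\<lambda>s. pz (u s)) has_field_derivative pz (V t (u t))) (at t) \<and>
     ((\<lambda>s. pw (u s)) has_field_derivative pw (V t (u t))) (at t))"

definition has_hamiltonian ::
  "(complex \<Rightarrow> phase \<Rightarrow> phase) \<Rightarrow> (complex \<Rightarrow> phase \<Rightarrow> complex) \<Rightarrow> bool" where
  "has_hamiltonian V H \<longleftrightarrow> (\<forall>t x y z w.
     ((\<lambda>\<eta>. H t (x, \<eta>, z, w)) has_field_derivative px (V t (x, y, z, w))) (at y) \<and>
     ((\<lambda>\<xi>. H t (\<xi>, y, z, w)) has_field_derivative - py (V t (x, y, z, w))) (at x) \<and>
     ((\<lambda>\<omega>. H t (x, y, z, \<omega>)) has_field_derivative pz (V t (x, y, z, w))) (at w) \<and>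
     ((\<lambda>\<zeta>. H t (x, y, \<zeta>, w)) has_field_derivative - pw (V t (x, y, z, w))) (at z))"

inductive polynomial_fun :: "(complex \<Rightarrow> phase \<Rightarrow> complex) \<Rightarrow> bool" where
  const: "polynomial_fun (\<lambda>t p. c)"
| time: "polynomial_fun (\<lambda>t p. t)"
| x: "polynomial_fun (\<lambda>t p. px p)"
| y: "polynomial_fun (\<lambda>t p. py p)"
| z: "polynomial_fun (\<lambda>t p. pz p)"
| w: "polynomial_fun (\<lambda>t p. pw p)"
| add: "polynomial_fun f \<Longrightarrow> polynomial_fun g \<Longrightarrow> polynomial_fun (\<lambda>t p. f t p + g t p)"
| mult: "polynomial_fun f \<Longrightarrow> polynomial_fun g \<Longrightarrow> polynomial_fun (\<lambda>t p. f t p * g t p)"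

definition rational_fun_on ::
  "(complex \<Rightarrow> phase set) \<Rightarrow> (complex \<Rightarrow> phase \<Rightarrow> complex) \<Rightarrow> bool" where
  "rational_fun_on D f \<longleftrightarrow> (\<exists>P Q. polynomial_fun P \<and> polynomial_fun Q \<and>
     (\<forall>t. \<forall>p\<in>D t. Q t p \<noteq> 0 \<and> f t p = P t p / Q t p))"

definition rational_map_on ::
  "(complex \<Rightarrow> phase set) \<Rightarrow> (complex \<Rightarrow> phase \<Rightarrow> phase) \<Rightarrow> bool" where
  "rational_map_on D \<phi> \<longleftrightarrow>
     rational_fun_on D (\<lambda>t p. px (\<phi> t p)) \<and> rational_fun_on D (\<lambda>t p. py (\<phi> t p)) \<and>
     rational_fun_on D (\<lambda>t p. pz (\<phi> t p)) \<and> rational_fun_on D (\<lambda>t p. pw (\<phi> t p))"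

text \<open>The 2-form \<open>dx \<and> dy + dz \<and> dw\<close>, evaluated on two tangent vectors.\<close>

definition symplectic_form :: "phase \<Rightarrow> phase \<Rightarrow> complex" where
  "symplectic_form a b = (px a * py b - py a * px b) + (pz a * pw b - pw a * pz b)"

text \<open>The derivative of the library is only real-linear on complex spaces, so
  complex-linearity is required separately.\<close>

definition symplectic_on :: "phase set \<Rightarrow> (phase \<Rightarrow> phase) \<Rightarrow> bool" where
  "symplectic_on U f \<longleftrightarrow> (\<forall>p\<in>U. \<exists>A. (f has_derivative A) (at p) \<and>
     (\<forall>c v. A (cscale c v) = cscale c (A v)) \<and>
     (\<forall>a b. symplectic_form (A a) (A b) = symplectic_form a b))"

text \<open>The time-dependent change of variables \<open>\<phi>\<close> has domain \<open>D t\<close> and range \<open>D' t\<close> at time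
  \<open>t\<close>. It is invertible, and a curve in the domain solves \<open>V\<close> iff the transformed curve
  solves \<open>V'\<close>; by invertibility every curve in the range is the transform of exactly one
  curve in the domain.\<close>

definition equivalent_via :: "(complex \<Rightarrow> phase set) \<Rightarrow> (complex \<Rightarrow> phase set) \<Rightarrow>
    (complex \<Rightarrow> phase \<Rightarrow> phase) \<Rightarrow> (complex \<Rightarrow> phase \<Rightarrow> phase) \<Rightarrow> (complex \<Rightarrow> phase \<Rightarrow> phase) \<Rightarrow> bool" where
  "equivalent_via D D' \<phi> V V' \<longleftrightarrow>
     (\<forall>t. bij_betw (\<phi> t) (D t) (D' t)) \<and>
     (\<forall>T u. open T \<and> (\<forall>t\<in>T. u t \<in> D t) \<longrightarrow>
        (solution V T u \<longleftrightarrow> solution V' T (\<lambda>t. \<phi> t (u t))))"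

fun system0 :: "complex \<Rightarrow> complex \<Rightarrow> complex \<Rightarrow> phase \<Rightarrow> phase" where
  "system0 \<alpha>2 \<alpha>3 t (x, y, z, w) =
     (- 2 * x^2 + 4 * y - 3 * w - 2 * t,
      4 * x * y + 2 * \<alpha>2,
      z^2 + 2 * w - 3 * y + t,
      - 2 * z * w - \<alpha>3)"

fun hamiltonian0 :: "complex \<Rightarrow> complex \<Rightarrow> complex \<Rightarrow> phase \<Rightarrow> complex" where
  "hamiltonian0 \<alpha>2 \<alpha>3 t (x, y, z, w) =
     - 2 * x^2 * y + 2 * y^2 - 2 * t * y - 2 * \<alpha>2 * x + z^2 * w + w^2 + t * w + \<alpha>3 * z - 3 * y * w"

lemma has_hamiltonian_system0: "has_hamiltonian (system0 \<alpha>2 \<alpha>3) (hamiltonian0 \<alpha>2 \<alpha>3)"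
  unfolding has_hamiltonian_def
  by (auto intro!: derivative_eq_intros simp: algebra_simps)

fun system1 :: "complex \<Rightarrow> complex \<Rightarrow> complex \<Rightarrow> phase \<Rightarrow> phase" where
  "system1 \<alpha>1 \<alpha>3 t (x, y, z, w) =
     (2 * x^2 + 4 * y + 2 * t - z * w^2 + \<alpha>3 * w,
      - 4 * x * y + 2 * z * w + 2 * \<alpha>1,
      - 2 * x * z - 2 * y * z * w + \<alpha>3 * y,
      y * w^2 + 2 * x * w + 1)"

fun hamiltonian1 :: "complex \<Rightarrow> complex \<Rightarrow> complex \<Rightarrow> phase \<Rightarrow> complex" where
  "hamiltonian1 \<alpha>1 \<alpha>3 t (x, y, z, w) =
     2 * x^2 * y + 2 * y^2 + 2 * t * y - y * z * w^2 + \<alpha>3 * y * w - 2 * x * z * w - 2 * \<alpha>1 * x - z"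

fun system2 :: "complex \<Rightarrow> complex \<Rightarrow> complex \<Rightarrow> phase \<Rightarrow> phase" where
  "system2 \<alpha>1 \<alpha>3 t (x, y, z, w) =
     (2 * x^2 + 4 * y - z + 2 * t,
      - 4 * x * y - 2 * z * w - 2 * \<alpha>1,
      - 2 * z * w + 2 * x * z + \<alpha>3,
      w^2 - 2 * x * w + y)"

fun hamiltonian2 :: "complex \<Rightarrow> complex \<Rightarrow> complex \<Rightarrow> phase \<Rightarrow> complex" where
  "hamiltonian2 \<alpha>1 \<alpha>3 t (x, y, z, w) =
     2 * x^2 * y + 2 * y^2 - y * z + 2 * t * y + 2 * \<alpha>1 * x + 2 * x * z * w + \<alpha>3 * w - z * w^2"

text \<open>Since \<open>a / 0 = 0\<close>, \<open>phi1\<close> is meaningful only where \<open>- t - w - x\<^sup>2 + y \<noteq> 0\<close>.\<close>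

fun phi1 :: "complex \<Rightarrow> complex \<Rightarrow> phase \<Rightarrow> phase" where
  "phi1 \<alpha>1 t (x, y, z, w) =
     (x - ((x + z) * w - \<alpha>1) / (- t - w - x^2 + y),
      - t - w - x^2 + y,
      - w * (- t - w - x^2 + y),
      (x + z) / (- t - w - x^2 + y))"

fun phi2 :: "complex \<Rightarrow> phase \<Rightarrow> phase" where
  "phi2 t (x, y, z, w) = (x, - t - w - x^2 + y, - w, x + z)"

definition domain1 :: "complex \<Rightarrow> phase set" where
  "domain1 t = {(x, y, z, w). - t - w - x^2 + y \<noteq> 0}"

definition range1 :: "complex \<Rightarrow> phase set" where
  "range1 t = {(x, y, z, w). y \<noteq> 0}"

end

theory Submission
  imports Defs
begin

text \<open>
  Both transformations come from one computation, because \<open>phi1\<close> factors through \<open>phi2\<close>: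
  with \<open>(X, Y, Z, W) = phi2 t (x, y, z, w)\<close> one has \<open>(x + z) * w - \<alpha>1 = - (Z * W + \<alpha>1)\<close>, so
  \<open>phi1\<close> is \<open>phi2\<close> followed by the time-independent map
  \<open>(X, Y, Z, W) \<mapsto> (X + (Z * W + \<alpha>1) / Y, Y, Z * Y, W / Y)\<close> on \<open>Y \<noteq> 0\<close>, called
  \<open>rescale\<close> below. It rescales the conjugate pair \<open>(Z, W)\<close> by \<open>Y\<close>, which keeps the product
  \<open>Z * W\<close> and changes the 2-form by \<open>- d(Z * W) \<and> dY / Y\<close>; adding \<open>Z * W / Y\<close> to \<open>X\<close>
  compensates for this. The further term \<open>\<alpha>1 / Y\<close> does not affect the 2-form, being a
  function of \<open>Y\<close> alone; it is what cancels the poles in \<open>Y\<close>, so that the transformed system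
  is polynomial. Both factors have explicit inverses: a polynomial map for \<open>phi2\<close>, and for
  \<open>rescale\<close> a map of the same kind, since \<open>Z * W\<close> and \<open>Y\<close> are unchanged.

  Symplecticity and the equivalence of systems are both stable under composition, so it
  remains to treat the two factors. There, the chain rule turns each claim into an identity
  between rational functions (polynomials for \<open>phi2\<close>). The parameter relation
  \<open>2 * \<alpha>1 + 2 * \<alpha>2 + \<alpha>3 = 1\<close> enters at one place: the explicit \<open>- t\<close> in the second
  component of \<open>phi2\<close> adds \<open>- 1\<close> to its time derivative, and the relation rewrites the
  resulting constant \<open>2 * \<alpha>2 + \<alpha>3 - 1\<close> as \<open>- 2 * \<alpha>1\<close>.
\<close>

section \<open>Changes of variables in non-autonomous systems\<close>

lemma solution_componentsD:
  assumes "solution V T (\<lambda>t. (x t, y t, z t, w t))" "t \<in> T"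
    and "V t (x t, y t, z t, w t) = (x', y', z', w')"
  shows "(x has_field_derivative x') (at t)" "(y has_field_derivative y') (at t)"
    "(z has_field_derivative z') (at t)" "(w has_field_derivative w') (at t)"
  using assms by (auto simp: solution_def)

lemma solution_cong:
  assumes "open T" "\<And>t. t \<in> T \<Longrightarrow> u t = v t"
  shows "solution V T u \<longleftrightarrow> solution V T v"
proof -
  have transfer: "solution V T g" if f: "solution V T f" and eq: "\<And>t. t \<in> T \<Longrightarrow> f t = g t" for f g
    unfolding solution_def
  proof (intro ballI conjI)
    fix t assume t: "t \<in> T"
    note D = f[unfolded solution_def, rule_format, OF t, unfolded eq[OF t]]
    note tr = has_field_derivative_transform_within_open[OF _ \<open>open T\<close> t]
    show "((\<lambda>s. px (g s)) has_field_derivative px (V t (g t))) (at t)"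
      using D by (auto intro: tr simp: eq)
    show "((\<lambda>s. py (g s)) has_field_derivative py (V t (g t))) (at t)"
      using D by (auto intro: tr simp: eq)
    show "((\<lambda>s. pz (g s)) has_field_derivative pz (V t (g t))) (at t)"
      using D by (auto intro: tr simp: eq)
    show "((\<lambda>s. pw (g s)) has_field_derivative pw (V t (g t))) (at t)"
      using D by (auto intro: tr simp: eq)
  qed
  show ?thesis using transfer[of u v] transfer[of v u] assms(2) by auto
qed

text \<open>With an explicit inverse it is enough that each of the two maps sends solutions to
  solutions: a transformed curve is carried back to the original one, on an open set of times,
  so that the derivatives agree as well. The two premises are written with four component
  functions because this is the form to which the chain rule applies.\<close>

lemma equivalent_viaI:
  assumes into: "\<And>t p. p \<in> D t \<Longrightarrow> \<phi> t p \<in> D' t" "\<And>t q. q \<in> D' t \<Longrightarrow> \<psi> t q \<in> D t"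
    and inverse: "\<And>t p. p \<in> D t \<Longrightarrow> \<psi> t (\<phi> t p) = p" "\<And>t q. q \<in> D' t \<Longrightarrow> \<phi> t (\<psi> t q) = q"
    and forward: "\<And>T x y z w. \<lbrakk>\<forall>t\<in>T. (x t, y t, z t, w t) \<in> D t; solution V T (\<lambda>t. (x t, y t, z t, w t))\<rbrakk>
        \<Longrightarrow> solution V' T (\<lambda>t. \<phi> t (x t, y t, z t, w t))"
    and backward: "\<And>T x y z w. \<lbrakk>\<forall>t\<in>T. (x t, y t, z t, w t) \<in> D' t; solution V' T (\<lambda>t. (x t, y t, z t, w t))\<rbrakk>
        \<Longrightarrow> solution V T (\<lambda>t. \<psi> t (x t, y t, z t, w t))"
  shows "equivalent_via D D' \<phi> V V'"
  unfolding equivalent_via_def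
proof (intro conjI allI impI)
  show "bij_betw (\<phi> t) (D t) (D' t)" for t
    by (rule bij_betw_byWitness[where f' = "\<psi> t"]) (auto simp: into inverse)
next
  fix T u assume A: "open T \<and> (\<forall>t\<in>T. u t \<in> D t)"
  have components: "solution V T u = solution V T (\<lambda>t. (px (u t), py (u t), pz (u t), pw (u t)))" for u V
    by simp
  show "solution V T u \<longleftrightarrow> solution V' T (\<lambda>t. \<phi> t (u t))"
  proof
    assume "solution V T u"
    then show "solution V' T (\<lambda>t. \<phi> t (u t))"
      using forward[of T "\<lambda>t. px (u t)" "\<lambda>t. py (u t)" "\<lambda>t. pz (u t)" "\<lambda>t. pw (u t)"] A by simp
  next
    define v where "v = (\<lambda>t. \<phi> t (u t))"
    assume "solution V' T (\<lambda>t. \<phi> t (u t))"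
    then have "solution V T (\<lambda>t. \<psi> t (v t))"
      using backward[of T "\<lambda>t. px (v t)" "\<lambda>t. py (v t)" "\<lambda>t. pz (v t)" "\<lambda>t. pw (v t)"] A into(1)
      by (simp add: v_def)
    then show "solution V T u"
      using solution_cong[of T u "\<lambda>t. \<psi> t (v t)" V] A by (auto simp: v_def inverse)
  qed
qed

text \<open>The first range may exceed the second domain; the composition then lives on the part of
  the first domain that is sent into the second. For \<open>phi1\<close> this removes the zero set of its
  denominator.\<close>

lemma equivalent_via_compose:
  assumes \<phi>: "equivalent_via D D' \<phi> V V'" and \<psi>: "equivalent_via E E' \<psi> V' V''"
    and "\<And>t. E t \<subseteq> D' t"
  shows "equivalent_via (\<lambda>t. {p \<in> D t. \<phi> t p \<in> E t}) E' (\<lambda>t p. \<psi> t (\<phi> t p)) V V''"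
  unfolding equivalent_via_def
proof (intro conjI allI impI)
  fix t
  have bij: "bij_betw (\<phi> t) (D t) (D' t)" "bij_betw (\<psi> t) (E t) (E' t)"
    using \<phi> \<psi> by (auto simp: equivalent_via_def)
  have "bij_betw (\<phi> t) {p \<in> D t. \<phi> t p \<in> E t} (E t)"
  proof (rule bij_betw_subset[OF bij(1)])
    show "\<phi> t ` {p \<in> D t. \<phi> t p \<in> E t} = E t"
    proof (intro equalityI subsetI)
      fix q assume q: "q \<in> E t"
      then have "q \<in> \<phi> t ` D t"
        using bij_betw_imp_surj_on[OF bij(1)] assms(3)[of t] by (simp add: subsetD)
      then show "q \<in> \<phi> t ` {p \<in> D t. \<phi> t p \<in> E t}"
        using q by (elim imageE) simp
    qed (elim imageE, simp)
  qed blast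
  then show "bij_betw (\<lambda>p. \<psi> t (\<phi> t p)) {p \<in> D t. \<phi> t p \<in> E t} (E' t)"
    using bij_betw_trans[OF _ bij(2)] by (simp add: comp_def)
next
  fix T u assume "open T \<and> (\<forall>t\<in>T. u t \<in> {p \<in> D t. \<phi> t p \<in> E t})"
  then show "solution V T u \<longleftrightarrow> solution V'' T (\<lambda>t. \<psi> t (\<phi> t (u t)))"
    using \<phi> \<psi> by (simp add: equivalent_via_def)
qed

text \<open>Complex-linearity and preservation of the form both pass to the product of the
  derivatives.\<close>

lemma symplectic_on_compose:
  assumes f: "symplectic_on U f" and g: "symplectic_on U' g" and "f ` U \<subseteq> U'"
  shows "symplectic_on U (\<lambda>p. g (f p))"
  unfolding symplectic_on_def
proof
  fix p assume "p \<in> U"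
  then obtain A where A: "(f has_derivative A) (at p)" "\<And>c v. A (cscale c v) = cscale c (A v)"
      "\<And>a b. symplectic_form (A a) (A b) = symplectic_form a b"
    using f unfolding symplectic_on_def by blast
  have "f p \<in> U'" using \<open>p \<in> U\<close> assms(3) by auto
  then obtain B where B: "(g has_derivative B) (at (f p))" "\<And>c v. B (cscale c v) = cscale c (B v)"
      "\<And>a b. symplectic_form (B a) (B b) = symplectic_form a b"
    using g unfolding symplectic_on_def by blast
  have "((\<lambda>p. g (f p)) has_derivative (\<lambda>v. B (A v))) (at p)"
    using has_derivative_compose[OF A(1) B(1)] .
  then show "\<exists>C. ((\<lambda>p. g (f p)) has_derivative C) (at p) \<and>
      (\<forall>c v. C (cscale c v) = cscale c (C v)) \<and>
      (\<forall>a b. symplectic_form (C a) (C b) = symplectic_form a b)"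
    using A(2,3) B(2,3) by (intro exI[of _ "\<lambda>v. B (A v)"]) simp
qed

section \<open>The polynomial change of variables\<close>

fun phi2_inv :: "complex \<Rightarrow> phase \<Rightarrow> phase" where
  "phi2_inv t (x, y, z, w) = (x, t - z + x^2 + y, w - x, - z)"

lemma equivalent_via_phi2:
  assumes par: "2 * \<alpha>1 + 2 * \<alpha>2 + \<alpha>3 = 1"
  shows "equivalent_via (\<lambda>t. UNIV) (\<lambda>t. UNIV) phi2 (system0 \<alpha>2 \<alpha>3) (system2 \<alpha>1 \<alpha>3)"
proof (rule equivalent_viaI[where \<psi> = phi2_inv])
  have \<alpha>3: "\<alpha>3 = 1 - 2 * \<alpha>1 - 2 * \<alpha>2" using par by (simp add: algebra_simps)
  fix T and x y z w :: "complex \<Rightarrow> complex"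
  {
    assume "solution (system0 \<alpha>2 \<alpha>3) T (\<lambda>t. (x t, y t, z t, w t))"
    then show "solution (system2 \<alpha>1 \<alpha>3) T (\<lambda>t. phi2 t (x t, y t, z t, w t))"
      unfolding solution_def
      by (auto intro!: derivative_eq_intros dest!: bspec simp: \<alpha>3)
        (simp_all add: algebra_simps power2_eq_square)
  next
    assume "solution (system2 \<alpha>1 \<alpha>3) T (\<lambda>t. (x t, y t, z t, w t))"
    then show "solution (system0 \<alpha>2 \<alpha>3) T (\<lambda>t. phi2_inv t (x t, y t, z t, w t))"
      unfolding solution_def
      by (auto intro!: derivative_eq_intros dest!: bspec simp: \<alpha>3)
        (simp_all add: algebra_simps power2_eq_square)
  }
qed auto

lemma symplectic_phi2: "symplectic_on UNIV (phi2 t)"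
  unfolding symplectic_on_def
proof
  fix p :: phase
  have phi2: "phi2 t = (\<lambda>p. (px p, - t - pw p - (px p)^2 + py p, - pw p, px p + pz p))"
    by (rule ext) (auto simp: split_paired_all)
  define A :: "phase \<Rightarrow> phase" where
    "A = (\<lambda>v. (px v, - pw v - 2 * px p * px v + py v, - pw v, px v + pz v))"
  have "(phi2 t has_derivative A) (at p)"
    unfolding phi2 A_def by (auto intro!: derivative_eq_intros)
  moreover have "A (cscale c v) = cscale c (A v)" for c v
    by (simp add: A_def cscale_def algebra_simps)
  moreover have "symplectic_form (A a) (A b) = symplectic_form a b" for a b
    by (simp add: A_def symplectic_form_def algebra_simps)
  ultimately show "\<exists>A. (phi2 t has_derivative A) (at p) \<and>
      (\<forall>c v. A (cscale c v) = cscale c (A v)) \<and>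
      (\<forall>a b. symplectic_form (A a) (A b) = symplectic_form a b)" by blast
qed

section \<open>The rational change of variables\<close>

fun rescale :: "complex \<Rightarrow> phase \<Rightarrow> phase" where
  "rescale \<alpha>1 (x, y, z, w) = (x + (z * w + \<alpha>1) / y, y, z * y, w / y)"

fun rescale_inv :: "complex \<Rightarrow> phase \<Rightarrow> phase" where
  "rescale_inv \<alpha>1 (x, y, z, w) = (x - (z * w + \<alpha>1) / y, y, z / y, w * y)"

lemma phi1_eq_rescale_phi2: "phi1 \<alpha>1 t p = rescale \<alpha>1 (phi2 t p)"
proof -
  obtain x y z w where p: "p = (x, y, z, w)" by (metis prod.exhaust)
  have "- ((x + z) * w - \<alpha>1) = - w * (x + z) + \<alpha>1" by (simp add: algebra_simps)
  then have "x - ((x + z) * w - \<alpha>1) / d = x + (- w * (x + z) + \<alpha>1) / d" for d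
    by (metis diff_conv_add_uminus minus_divide_left)
  then show ?thesis by (simp add: p)
qed

text \<open>\<open>phi1\<close> is defined exactly where \<open>phi2\<close> lands in the domain of \<open>rescale\<close>: the shape in
  which a composition of equivalences produces its domain.\<close>

lemma domain1_eq: "domain1 t = {p \<in> UNIV. phi2 t p \<in> range1 t}"
  by (auto simp: domain1_def range1_def)

text \<open>In the first component the terms of order \<open>1 / y\<^sup>2\<close> are
  \<open>(z * w + \<alpha>1) * (2 * z * w + 2 * \<alpha>1)\<close>, from differentiating \<open>1 / y\<close>, and
  \<open>2 * (z * w + \<alpha>1)^2\<close>, from squaring the new \<open>x\<close>; they agree because of the choice of the
  constant \<open>\<alpha>1\<close> in \<open>rescale\<close>.\<close>

lemma equivalent_via_rescale:
  "equivalent_via range1 range1 (\<lambda>t. rescale \<alpha>1) (system2 \<alpha>1 \<alpha>3) (system1 \<alpha>1 \<alpha>3)"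
proof (rule equivalent_viaI[where \<psi> = "\<lambda>t. rescale_inv \<alpha>1"])
  fix T and x y z w :: "complex \<Rightarrow> complex"
  assume nz: "\<forall>t\<in>T. (x t, y t, z t, w t) \<in> range1 t"
  {
    assume sol: "solution (system2 \<alpha>1 \<alpha>3) T (\<lambda>t. (x t, y t, z t, w t))"
    \<comment> \<open>On a singleton being a solution is a condition at one time, where \<open>y\<close> is known to be nonzero.\<close>
    have "solution (system1 \<alpha>1 \<alpha>3) {t} (\<lambda>t. rescale \<alpha>1 (x t, y t, z t, w t))" if t: "t \<in> T" for t
    proof -
      have y: "y t \<noteq> 0" using nz t by (auto simp: range1_def)
      note [derivative_intros] = solution_componentsD[OF sol t system2.simps]
      show ?thesis
        unfolding solution_def
        by (auto intro!: derivative_eq_intros simp: y)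
          (simp_all add: y field_simps power2_eq_square)
    qed
    then show "solution (system1 \<alpha>1 \<alpha>3) T (\<lambda>t. rescale \<alpha>1 (x t, y t, z t, w t))"
      by (simp add: solution_def)
  next
    assume sol: "solution (system1 \<alpha>1 \<alpha>3) T (\<lambda>t. (x t, y t, z t, w t))"
    have "solution (system2 \<alpha>1 \<alpha>3) {t} (\<lambda>t. rescale_inv \<alpha>1 (x t, y t, z t, w t))" if t: "t \<in> T" for t
    proof -
      have y: "y t \<noteq> 0" using nz t by (auto simp: range1_def)
      note [derivative_intros] = solution_componentsD[OF sol t system1.simps]
      show ?thesis
        unfolding solution_def
        by (auto intro!: derivative_eq_intros simp: y)
          (simp_all add: y field_simps power2_eq_square)
    qed
    then show "solution (system2 \<alpha>1 \<alpha>3) T (\<lambda>t. rescale_inv \<alpha>1 (x t, y t, z t, w t))"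
      by (simp add: solution_def)
  }
qed (auto simp: range1_def)

lemma symplectic_rescale: "symplectic_on (range1 t) (rescale \<alpha>1)"
  unfolding symplectic_on_def
proof
  fix p assume "p \<in> range1 t"
  then have y: "py p \<noteq> 0" by (auto simp: range1_def)
  have rescale: "rescale \<alpha>1 = (\<lambda>p. (px p + (pz p * pw p + \<alpha>1) / py p, py p, pz p * py p, pw p / py p))"
    by (rule ext) (auto simp: split_paired_all)
  define A :: "phase \<Rightarrow> phase" where
    "A = (\<lambda>v. (px v + (pz v * pw p + pz p * pw v) / py p - (pz p * pw p + \<alpha>1) * py v / (py p)^2,
               py v, pz v * py p + pz p * py v, pw v / py p - pw p * py v / (py p)^2))"
  have "(rescale \<alpha>1 has_derivative A) (at p)"
    unfolding rescale A_def using y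
    by (auto intro!: derivative_eq_intros simp: field_simps power2_eq_square)
  moreover have "A (cscale c v) = cscale c (A v)" for c v
    using y by (simp add: A_def cscale_def field_simps)
  moreover have "symplectic_form (A a) (A b) = symplectic_form a b" for a b
    using y by (simp add: A_def symplectic_form_def field_simps power2_eq_square)
  ultimately show "\<exists>A. (rescale \<alpha>1 has_derivative A) (at p) \<and>
      (\<forall>c v. A (cscale c v) = cscale c (A v)) \<and>
      (\<forall>a b. symplectic_form (A a) (A b) = symplectic_form a b)" by blast
qed

section \<open>Polynomiality and rationality\<close>

lemma polynomial_fun_uminus: "polynomial_fun f \<Longrightarrow> polynomial_fun (\<lambda>t p. - f t p)"
  using polynomial_fun.mult[OF polynomial_fun.const[of "- 1"]] by simp

lemma polynomial_fun_diff:
  "polynomial_fun f \<Longrightarrow> polynomial_fun g \<Longrightarrow> polynomial_fun (\<lambda>t p. f t p - g t p)"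
  using polynomial_fun.add[OF _ polynomial_fun_uminus] by simp

lemma polynomial_fun_power: "polynomial_fun f \<Longrightarrow> polynomial_fun (\<lambda>t p. f t p ^ n)"
  by (induction n) (simp_all add: polynomial_fun.intros)

lemmas polynomial_fun_intros =
  polynomial_fun.intros polynomial_fun_uminus polynomial_fun_diff polynomial_fun_power

lemma polynomial_hamiltonian1: "polynomial_fun (hamiltonian1 \<alpha>1 \<alpha>3)"
proof -
  have "hamiltonian1 \<alpha>1 \<alpha>3 = (\<lambda>t p. 2 * (px p)^2 * py p + 2 * (py p)^2 + 2 * t * py p
      - py p * pz p * (pw p)^2 + \<alpha>3 * py p * pw p - 2 * px p * pz p * pw p - 2 * \<alpha>1 * px p - pz p)"
    by (intro ext) (auto simp: split_paired_all)
  then show ?thesis by (simp only:) (intro polynomial_fun_intros)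
qed

lemma polynomial_hamiltonian2: "polynomial_fun (hamiltonian2 \<alpha>1 \<alpha>3)"
proof -
  have "hamiltonian2 \<alpha>1 \<alpha>3 = (\<lambda>t p. 2 * (px p)^2 * py p + 2 * (py p)^2 - py p * pz p + 2 * t * py p
      + 2 * \<alpha>1 * px p + 2 * px p * pz p * pw p + \<alpha>3 * pw p - pz p * (pw p)^2)"
    by (intro ext) (auto simp: split_paired_all)
  then show ?thesis by (simp only:) (intro polynomial_fun_intros)
qed

text \<open>All four components are polynomials over the one denominator \<open>- t - w - x\<^sup>2 + y\<close>.\<close>

lemma rational_phi1: "rational_map_on domain1 (phi1 \<alpha>1)"
proof -
  define Q :: "complex \<Rightarrow> phase \<Rightarrow> complex" where "Q = (\<lambda>t p. - t - pw p - (px p)^2 + py p)"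
  have Q: "polynomial_fun Q" unfolding Q_def by (intro polynomial_fun_intros)
  have Q_nz: "Q t p \<noteq> 0" if "p \<in> domain1 t" for t p
    using that by (auto simp: domain1_def Q_def)
  have phi1: "phi1 \<alpha>1 t p = (px p - ((px p + pz p) * pw p - \<alpha>1) / Q t p, Q t p,
      - pw p * Q t p, (px p + pz p) / Q t p)" for t p
    by (cases p) (auto simp: Q_def)
  have over_Q: "rational_fun_on domain1 f"
    if "polynomial_fun P" "\<And>t p. Q t p \<noteq> 0 \<Longrightarrow> f t p = P t p / Q t p" for f P
    unfolding rational_fun_on_def using that Q Q_nz by blast
  have "rational_fun_on domain1 (\<lambda>t p. px (phi1 \<alpha>1 t p))"
    by (rule over_Q[where P = "\<lambda>t p. px p * Q t p - ((px p + pz p) * pw p - \<alpha>1)"])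
      (intro polynomial_fun_intros Q, simp add: phi1 field_simps)
  moreover have "rational_fun_on domain1 (\<lambda>t p. py (phi1 \<alpha>1 t p))"
    by (rule over_Q[where P = "\<lambda>t p. Q t p * Q t p"])
      (intro polynomial_fun_intros Q, simp add: phi1)
  moreover have "rational_fun_on domain1 (\<lambda>t p. pz (phi1 \<alpha>1 t p))"
    by (rule over_Q[where P = "\<lambda>t p. - pw p * Q t p * Q t p"])
      (intro polynomial_fun_intros Q, simp add: phi1)
  moreover have "rational_fun_on domain1 (\<lambda>t p. pw (phi1 \<alpha>1 t p))"
    by (rule over_Q[where P = "\<lambda>t p. px p + pz p"])
      (intro polynomial_fun_intros, simp add: phi1)
  ultimately show ?thesis by (simp add: rational_map_on_def)
qed

section \<open>Equivalence of the three Hamiltonian systems\<close>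

lemma has_hamiltonian_system1: "has_hamiltonian (system1 \<alpha>1 \<alpha>3) (hamiltonian1 \<alpha>1 \<alpha>3)"
  unfolding has_hamiltonian_def
  by (auto intro!: derivative_eq_intros simp: algebra_simps power2_eq_square)

lemma has_hamiltonian_system2: "has_hamiltonian (system2 \<alpha>1 \<alpha>3) (hamiltonian2 \<alpha>1 \<alpha>3)"
  unfolding has_hamiltonian_def
  by (auto intro!: derivative_eq_intros simp: algebra_simps power2_eq_square)

theorem theorem4p1:
  fixes \<alpha>1 \<alpha>2 \<alpha>3 :: complex
  assumes "2 * \<alpha>1 + 2 * \<alpha>2 + \<alpha>3 = 1"
  shows "(rational_map_on domain1 (phi1 \<alpha>1) \<and>
      (\<forall>t. symplectic_on (domain1 t) (phi1 \<alpha>1 t)) \<and>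
      equivalent_via domain1 range1 (phi1 \<alpha>1) (system0 \<alpha>2 \<alpha>3) (system1 \<alpha>1 \<alpha>3) \<and>
      has_hamiltonian (system1 \<alpha>1 \<alpha>3) (hamiltonian1 \<alpha>1 \<alpha>3) \<and>
      polynomial_fun (hamiltonian1 \<alpha>1 \<alpha>3)) \<and>
    ((\<forall>t. symplectic_on UNIV (phi2 t)) \<and>
      equivalent_via (\<lambda>t. UNIV) (\<lambda>t. UNIV) phi2 (system0 \<alpha>2 \<alpha>3) (system2 \<alpha>1 \<alpha>3) \<and>
      has_hamiltonian (system2 \<alpha>1 \<alpha>3) (hamiltonian2 \<alpha>1 \<alpha>3) \<and>
      polynomial_fun (hamiltonian2 \<alpha>1 \<alpha>3))"
proof -
  have phi1: "phi1 \<alpha>1 = (\<lambda>t p. rescale \<alpha>1 (phi2 t p))"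
    by (intro ext) (rule phi1_eq_rescale_phi2)
  have domain1: "domain1 = (\<lambda>t. {p \<in> UNIV. phi2 t p \<in> range1 t})"
    by (intro ext) (rule domain1_eq)
  have "symplectic_on (domain1 t) (phi2 t)" for t
    using symplectic_phi2[of t] unfolding symplectic_on_def by blast
  then have "symplectic_on (domain1 t) (phi1 \<alpha>1 t)" for t
    unfolding phi1 by (rule symplectic_on_compose[OF _ symplectic_rescale]) (auto simp: domain1)
  moreover have "equivalent_via domain1 range1 (phi1 \<alpha>1) (system0 \<alpha>2 \<alpha>3) (system1 \<alpha>1 \<alpha>3)"
    unfolding phi1 domain1
    by (rule equivalent_via_compose[OF equivalent_via_phi2[OF assms] equivalent_via_rescale]) simp
  ultimately show ?thesis
    using rational_phi1 has_hamiltonian_system1 polynomial_hamiltonian1 symplectic_phi2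
      equivalent_via_phi2[OF assms] has_hamiltonian_system2 polynomial_hamiltonian2
    by blast
qed

end
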